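(* For every positive integer $\chi$ there are arbitrarily large positive integers $N$ for which there exist a graph $G$ and a tournament $T$ on the same $N$-vertex set $V$ such that $\chi(G) = \chi$ and, for every set $U \subseteq V$ of at most $\frac{\log N}{2\chi^2}$ vertices, $\chi(G[N_T^+(U)]) \leq 2$.
   Context: Graphs are finite and simple; a tournament is an orientation of a finite complete graph. $\chi(G)$ denotes the chromatic number of a graph $G$, and $G[S]$ the subgraph induced on a vertex set $S$. For a tournament $T$, $N_T^+(v)$ is the set of vertices $w$ such that $T$ has an arc from $v$ to $w$ (so $v \notin N_T^+(v)$), and for a vertex set $U$, $N_T^+(U) = \bigcup_{v \in U} N_T^+(v)$, which might contain vertices of $U$. $\log$ denotes the natural logarithm. *)

theory Defs
  imports Complex_Main "Graph_Theory.Digraph_Component" "Graph_Theory.Pair_Digraph"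
begin

text \<open>
  Finite simple graphs are the symmetric loop-free digraphs of \<^locale>\<open>pair_graph\<close>:
  an edge \<open>uv\<close> is the pair of arcs \<open>(u, v)\<close> and \<open>(v, u)\<close>.
\<close>

definition proper_colouring ::
    "('a, 'b) pre_digraph \<Rightarrow> nat \<Rightarrow> ('a \<Rightarrow> nat) \<Rightarrow> bool" where
  "proper_colouring G k c \<longleftrightarrow>
     (\<forall>v\<in>verts G. c v < k) \<and> (\<forall>u v. u \<rightarrow>\<^bsub>G\<^esub> v \<longrightarrow> c u \<noteq> c v)"

text \<open>
  A digraph with a loop has no proper colouring, and then the value below is unspecified;
  finite loop-free digraphs always have one (see \<open>chromatic_number_le_iff\<close>).
\<close>

definition chromatic_number :: "('a, 'b) pre_digraph \<Rightarrow> nat" where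
  "chromatic_number G = (LEAST k. \<exists>c. proper_colouring G k c)"

locale pair_tournament = pair_digraph T for T :: "'a pair_pre_digraph" +
  assumes exactly_one_arc:
    "\<lbrakk>u \<in> pverts T; v \<in> pverts T; u \<noteq> v\<rbrakk> \<Longrightarrow> (u, v) \<in> parcs T \<longleftrightarrow> (v, u) \<notin> parcs T"

definition out_nbrs :: "('a, 'b) pre_digraph \<Rightarrow> 'a \<Rightarrow> 'a set" where
  "out_nbrs T v = {w. v \<rightarrow>\<^bsub>T\<^esub> w}"

definition out_nbrs_set :: "('a, 'b) pre_digraph \<Rightarrow> 'a set \<Rightarrow> 'a set" where
  "out_nbrs_set T U = (\<Union>v\<in>U. out_nbrs T v)"

lemma chromatic_number_le_iff:
  assumes "fin_digraph G" and "loopfree_digraph G"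
  shows "chromatic_number G \<le> k \<longleftrightarrow> (\<exists>c. proper_colouring G k c)"
proof
  interpret G: fin_digraph G by fact
  interpret G: loopfree_digraph G by fact
  obtain f :: "'a \<Rightarrow> nat" where f: "bij_betw f (verts G) {0..<card (verts G)}"
    using ex_bij_betw_finite_nat[OF G.finite_verts] by blast
  have "f u \<noteq> f v" if uv: "u \<rightarrow>\<^bsub>G\<^esub> v" for u v
  proof -
    have "u \<in> verts G" "v \<in> verts G"
      using uv by (auto elim!: reachableE)
    moreover have "u \<noteq> v"
      using uv G.adj_not_same by blast
    ultimately show ?thesis
      using f by (auto simp: bij_betw_def dest: inj_onD)
  qed
  moreover have "f v < card (verts G)" if "v \<in> verts G" for v
    using bij_betwE[OF f] that by auto
  ultimately have "\<exists>c. proper_colouring G (card (verts G)) c"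
    unfolding proper_colouring_def by blast
  then have "\<exists>c. proper_colouring G (chromatic_number G) c"
    unfolding chromatic_number_def by (rule LeastI)
  moreover assume "chromatic_number G \<le> k"
  ultimately show "\<exists>c. proper_colouring G k c"
    unfolding proper_colouring_def by (meson less_le_trans)
next
  assume "\<exists>c. proper_colouring G k c"
  then show "chromatic_number G \<le> k"
    unfolding chromatic_number_def by (rule Least_le)
qed

end

theory Submission
  imports Defs "HOL-Library.Disjoint_Sets" "HOL-Library.FuncSet" "HOL-Library.Z2"
begin

text \<open>
  The vertices of \<open>G\<close> are sets \<open>A \<subseteq> {0, \<dots>, m}\<close> without two consecutive elements that have at most
  \<open>\<chi>\<close> gaps, that is, positions \<open>s < m\<close> with \<open>s \<notin> A\<close> and \<open>s + 1 \<notin> A\<close>; two vertices are adjacent when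
  they are disjoint. Three properties make this graph suitable. It is small: the gaps almost
  determine \<open>A\<close>, so there are at most \<open>2 (m + 1)^\<chi>\<close> vertices (\<open>card_sparse_gap_sets_le\<close>). For every
  \<open>s\<close>, the vertices that have no gap at \<open>s\<close> induce a bipartite graph, with colour classes given by
  \<open>s \<in> A\<close>. Yet its chromatic number is at least \<open>\<chi>\<close> (\<open>sparse_gap_sets_colours_ge\<close>).

  It remains to find a tournament in which every small set \<open>U\<close> admits an \<open>s\<close> such that all vertices
  with a gap at \<open>s\<close> lie outside \<open>N\<^sup>+(U)\<close>. Take an orientation of the pairs of positions in which every
  \<open>q = K \<chi>\<close> positions are beaten by a common one; a random orientation of \<open>m = 4^q\<close> positions does it
  (\<open>ex_dominating_orientation\<close>). Let \<open>A\<close> point to \<open>B\<close> whenever one gap of \<open>A\<close> beats all gaps of \<open>B\<close>; this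
  is never contradictory (\<open>ex_tournament_from_labels\<close>). If \<open>U\<close> has at most \<open>K\<close> vertices, some \<open>s\<close>
  beats all their gaps, and then every vertex with a gap at \<open>s\<close> points to all of \<open>U\<close>. The graph has about
  \<open>4^(K \<chi>\<^sup>2)\<close> vertices, which leaves room below \<open>exp (2 K \<chi>\<^sup>2)\<close>; isolated vertices and the removal of
  edges then give the exact order and chromatic number.

  The lower bound on the chromatic number is topological, as for Kneser graphs. Its source is a
  parity theorem (\<open>odd_card_alternating_signed_perms\<close>): if the nonzero sign vectors of length \<open>n\<close>
  are given signs so that antipodal vectors get opposite signs, then an odd number of maximal
  chains have alternating signs beginning with a prescribed one. A chain of this kind forces a
  monotone rating of the two sides of sign vectors to reach the value \<open>n\<close> (\<open>monotone_tucker\<close>), and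
  few colours would permit a rating with only smaller values.
\<close>

section \<open>Alternating chains of sign vectors\<close>

lemma even_card_if_fixpoint_free_involution:
  assumes "\<And>x. x \<in> S \<Longrightarrow> f x \<in> S" and "\<And>x. x \<in> S \<Longrightarrow> f (f x) = x"
    and "\<And>x. x \<in> S \<Longrightarrow> f x \<noteq> x"
  shows "even (card S)"
proof -
  have "(\<Sum>x\<in>S. 1 :: bit) = 0"
    by (rule sum_involution_eq_0[where h = f]) (use assms in simp_all)
  then have "even (of_nat (card S) :: bit)" by simp
  then show ?thesis by (simp only: even_of_nat_iff)
qed

fun alternating :: "bool \<Rightarrow> bool list \<Rightarrow> bool" where
  "alternating b [] \<longleftrightarrow> True"
| "alternating b (x # xs) \<longleftrightarrow> x = b \<and> alternating (\<not> b) xs"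

definition delete_nth :: "nat \<Rightarrow> 'a list \<Rightarrow> 'a list" where
  "delete_nth j xs = take j xs @ drop (Suc j) xs"

lemma alternating_map_Not: "alternating b (map Not xs) \<longleftrightarrow> alternating (\<not> b) xs"
  by (induction xs arbitrary: b) auto

text \<open>
  Deleting an entry of an alternating list of length at least two keeps it alternating only at the
  two ends, and the two results begin with different values, so exactly one begins with \<open>b\<close>. In a
  list that does not alternate, a deletion can only help at a repeated pair of neighbours, and then
  both members of the pair serve equally well.
\<close>
lemma odd_card_alternating_deletions:
  assumes "xs \<noteq> []"
  shows "odd (card {j. j < length xs \<and> alternating b (delete_nth j xs)})
    \<longleftrightarrow> alternating b xs \<or> alternating (\<not> b) xs"
  using assms
proof (induction xs arbitrary: b)
  case (Cons x xs)
  let ?D = "\<lambda>b ys. {j. j < length ys \<and> alternating b (delete_nth j ys)}"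
  have split: "?D b (x # xs)
    = (if alternating b xs then {0} else {}) \<union> (if x = b then Suc ` ?D (\<not> b) xs else {})"
  proof (rule set_eqI)
    fix j
    show "j \<in> ?D b (x # xs) \<longleftrightarrow>
      j \<in> (if alternating b xs then {0} else {}) \<union> (if x = b then Suc ` ?D (\<not> b) xs else {})"
      by (cases j) (auto simp: delete_nth_def)
  qed
  have "card (?D b (x # xs))
    = of_bool (alternating b xs) + (if x = b then card (?D (\<not> b) xs) else 0)"
    unfolding split by (subst card_Un_disjoint) (auto simp: card_image)
  moreover have "\<not> (alternating b xs \<and> alternating (\<not> b) xs)" if "xs \<noteq> []"
    using that by (cases xs) auto
  ultimately show ?case
    using Cons.IH[of "\<not> b"] by (cases "xs = []") auto
qed simp

text \<open>
  A set of pairs \<open>(i, b)\<close> that is injective in \<open>i\<close> is a sign vector: \<open>i\<close> carries the sign \<open>b\<close>, and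
  indices that do not occur carry \<open>0\<close>. Inclusion of sets is the face order of the boundary of the
  cross-polytope.
\<close>
abbreviation flip :: "(nat \<times> bool) set \<Rightarrow> (nat \<times> bool) set" where
  "flip X \<equiv> apsnd Not ` X"

text \<open>
  The prefixes of a signed permutation form a maximal chain of nonzero sign vectors, and every
  maximal chain arises so. Signed permutations are thus the facets of the barycentric subdivision
  of the boundary of the cross-polytope, a triangulated sphere.
\<close>
definition signed_perms :: "nat \<Rightarrow> (nat \<times> bool) list set" where
  "signed_perms n = {xs. distinct (map fst xs) \<and> fst ` set xs = {..<n}}"

definition prefix_values :: "('a set \<Rightarrow> 'b) \<Rightarrow> 'a list \<Rightarrow> 'b list" where
  "prefix_values s xs = map (\<lambda>i. s (set (take (Suc i) xs))) [0..<length xs]"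

lemma length_prefix_values [simp]: "length (prefix_values s xs) = length xs"
  by (simp add: prefix_values_def)

lemma delete_nth_prefix_values_cong:
  assumes "length ys = length xs"
    and "\<And>i. i < length xs \<Longrightarrow> i \<noteq> j \<Longrightarrow> set (take (Suc i) ys) = set (take (Suc i) xs)"
  shows "delete_nth j (prefix_values s ys) = delete_nth j (prefix_values s xs)"
  using assms
  by (cases "j \<le> length xs") (auto simp: delete_nth_def prefix_values_def take_map drop_map)

lemma prefix_values_snoc:
  "prefix_values s (xs @ [x]) = prefix_values s xs @ [s (insert x (set xs))]"
  by (auto simp: prefix_values_def)

lemma length_signed_perm: "xs \<in> signed_perms n \<Longrightarrow> length xs = n"
  unfolding signed_perms_def by (metis (mono_tags, lifting) card_lessThan distinct_card length_map list.set_map mem_Collect_eq)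

lemma finite_signed_perms: "finite (signed_perms n)"
proof (rule finite_subset)
  show "signed_perms n \<subseteq> {xs. set xs \<subseteq> {..<n} \<times> UNIV \<and> length xs = n}"
  proof
    fix xs assume xs: "xs \<in> signed_perms n"
    then have "fst ` set xs \<subseteq> {..<n}" by (simp add: signed_perms_def)
    then have "set xs \<subseteq> {..<n} \<times> UNIV" by fastforce
    then show "xs \<in> {xs. set xs \<subseteq> {..<n} \<times> UNIV \<and> length xs = n}"
      using length_signed_perm[OF xs] by blast
  qed
  show "finite {xs. set xs \<subseteq> {..<n} \<times> (UNIV :: bool set) \<and> length xs = n}"
    by (rule finite_lists_length_eq) simp
qed

lemma map_flip_signed_perm: "xs \<in> signed_perms n \<Longrightarrow> map (apsnd Not) xs \<in> signed_perms n"
  by (auto simp: signed_perms_def comp_def image_image)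

text \<open>
  A parity form of Ky Fan's lemma, for vertices ordered by inclusion. The proof counts, over the
  hemisphere \<open>D\<close> of the chains that give the sign \<open>True\<close> to the last coordinate, the pairs of a
  chain and one of its elements whose deletion leaves an alternating sequence of signs beginning
  with \<open>True\<close>. Chain by chain, the count has the parity of the number of alternating chains in \<open>D\<close>,
  which by antipodality is the number of alternating chains beginning with \<open>True\<close> on the whole
  sphere. Facet by facet, each facet inside the hemisphere lies in two chains, so only the equator
  counts, and the equator is the sphere of one dimension less.
\<close>
lemma odd_card_alternating_signed_perms:
  fixes s :: "(nat \<times> bool) set \<Rightarrow> bool"
  assumes antipodal: "\<And>X. \<lbrakk>X \<noteq> {}; inj_on fst X; fst ` X \<subseteq> {..<n}\<rbrakk> \<Longrightarrow> s (flip X) \<longleftrightarrow> \<not> s X"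
  shows "odd (card {xs \<in> signed_perms n. alternating True (prefix_values s xs)})"
  using assms
proof (induction n)
  case 0
  have "{xs \<in> signed_perms 0. alternating True (prefix_values s xs)} = {[]}"
    by (auto simp: signed_perms_def prefix_values_def)
  then show ?case by simp
next
  case (Suc n)
  note [simp] = finite_signed_perms
  have IH: "odd (card {xs \<in> signed_perms n. alternating True (prefix_values s xs)})"
    by (rule Suc.IH, rule Suc.prems) auto
  define D where "D = {xs \<in> signed_perms (Suc n). (n, True) \<in> set xs}"
  have finD: "finite D" by (simp add: D_def)
  have lenD: "length xs = Suc n" if "xs \<in> D" for xs
    using that length_signed_perm D_def by blast
  define Q where "Q xs j \<longleftrightarrow> alternating True (delete_nth j (prefix_values s xs))" for xs j
  define alt2 where "alt2 xs \<longleftrightarrow> alternating True (prefix_values s xs) \<or> alternating False (prefix_values s xs)" for xs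
  have row: "odd (card {j. j < Suc n \<and> Q xs j}) \<longleftrightarrow> alt2 xs" if "xs \<in> D" for xs
    using odd_card_alternating_deletions[of "prefix_values s xs" True] lenD[OF that]
    by (auto simp: Q_def alt2_def simp flip: length_0_conv)
  \<comment> \<open>Exchanging two neighbouring entries changes only the prefix that ends between them.\<close>
  have col: "even (card {xs \<in> D. Q xs j})" if j: "j < n" for j
  proof (rule even_card_if_fixpoint_free_involution[where f = "\<lambda>xs. xs[j := xs ! Suc j, Suc j := xs ! j]"])
    fix xs assume xs: "xs \<in> {xs \<in> D. Q xs j}"
    let ?ys = "xs[j := xs ! Suc j, Suc j := xs ! j]"
    have len: "length xs = Suc n" using xs lenD by blast
    have set_ys: "set ?ys = set xs" using j len by (intro set_swap) auto
    have "distinct (map fst ?ys)"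
      using xs j len distinct_swap[of j "map fst xs" "Suc j"]
      by (auto simp: D_def signed_perms_def map_update)
    then have "?ys \<in> D" using xs set_ys by (auto simp: D_def signed_perms_def)
    moreover have "delete_nth j (prefix_values s ?ys) = delete_nth j (prefix_values s xs)"
    proof (rule delete_nth_prefix_values_cong)
      fix i assume i: "i < length xs" "i \<noteq> j"
      show "set (take (Suc i) ?ys) = set (take (Suc i) xs)"
      proof (cases "i < j")
        case False
        then have "take (Suc i) ?ys = (take (Suc i) xs)[j := take (Suc i) xs ! Suc j, Suc j := take (Suc i) xs ! j]"
          using i by (simp add: take_update_swap)
        moreover have "set \<dots> = set (take (Suc i) xs)"
          using i False by (intro set_swap) auto
        ultimately show ?thesis by simp
      qed simp
    qed simp
    ultimately show "?ys \<in> {xs \<in> D. Q xs j}" using xs by (simp add: Q_def)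
    show "?ys[j := ?ys ! Suc j, Suc j := ?ys ! j] = xs"
      using j len by (auto intro!: nth_equalityI simp: nth_list_update)
    have "distinct xs" using xs by (auto simp: D_def signed_perms_def distinct_map)
    then have "xs ! j \<noteq> xs ! Suc j" using j len by (simp add: nth_eq_iff_index_eq)
    then have "?ys ! j \<noteq> xs ! j" using j len by simp
    then show "?ys \<noteq> xs" by metis
  qed
  let ?A = "{xs \<in> signed_perms n. alternating True (prefix_values s xs)}"
  \<comment> \<open>Reversing the last sign changes only the full prefix. It leaves \<open>D\<close> exactly when the last
    index is \<open>n\<close>, and these chains are the chains of the equator with the north pole added.\<close>
  have last_col: "odd (card {xs \<in> D. Q xs n})"
  proof -
    let ?top = "{xs \<in> D. Q xs n \<and> fst (last xs) = n}"
    let ?oth = "{xs \<in> D. Q xs n \<and> fst (last xs) \<noteq> n}"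
    have Qsnoc: "Q (ys @ [x]) n \<longleftrightarrow> alternating True (prefix_values s ys)" if "length ys = n" for ys x
      using that by (simp add: Q_def delete_nth_def prefix_values_snoc)
    have snocD: "\<exists>ys x. xs = ys @ [x] \<and> length ys = n" if "xs \<in> D" for xs
      using lenD[OF that] by (metis length_Suc_conv_rev)
    have "even (card ?oth)"
    proof (rule even_card_if_fixpoint_free_involution[where f = "\<lambda>xs. butlast xs @ [apsnd Not (last xs)]"])
      fix xs assume xs: "xs \<in> ?oth"
      then obtain ys x where e: "xs = ys @ [x]" and l: "length ys = n" using snocD by blast
      show "butlast xs @ [apsnd Not (last xs)] \<in> ?oth"
        using xs unfolding e by (auto simp: Qsnoc l D_def signed_perms_def)
      show "butlast (butlast xs @ [apsnd Not (last xs)]) @ [apsnd Not (last (butlast xs @ [apsnd Not (last xs)]))] = xs"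
        unfolding e by (cases x) auto
      show "butlast xs @ [apsnd Not (last xs)] \<noteq> xs"
        unfolding e by (cases x) auto
    qed
    moreover have "?top = (\<lambda>ys. ys @ [(n, True)]) ` ?A"
    proof (intro set_eqI iffI)
      fix xs assume xs: "xs \<in> ?top"
      then obtain ys x where e: "xs = ys @ [x]" and l: "length ys = n" using snocD by blast
      have d: "distinct (map fst xs)" "fst ` set xs = {..<Suc n}" "(n, True) \<in> set xs" "fst x = n"
        using xs by (auto simp: D_def signed_perms_def e)
      have n: "n \<notin> fst ` set ys" using d by (simp add: e)
      then have "(n, True) \<notin> set ys" by force
      then have x: "x = (n, True)" using d by (auto simp: e)
      have "fst ` set ys = {..<n}"
        by (rule insert_ident[THEN iffD1, of n]) (use d n in \<open>simp_all add: e x lessThan_Suc\<close>)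
      then have "ys \<in> ?A" using d xs by (simp add: e signed_perms_def Qsnoc l)
      then show "xs \<in> (\<lambda>ys. ys @ [(n, True)]) ` ?A" unfolding e x by (rule imageI)
    next
      fix xs assume "xs \<in> (\<lambda>ys. ys @ [(n, True)]) ` ?A"
      then obtain ys where ys: "ys \<in> ?A" and e: "xs = ys @ [(n, True)]" by blast
      have "xs \<in> signed_perms (Suc n)" using ys by (simp add: e signed_perms_def lessThan_Suc)
      then show "xs \<in> ?top"
        using ys by (simp add: e D_def Qsnoc length_signed_perm)
    qed
    then have "card ?top = card ?A" by (simp add: card_image inj_on_def)
    moreover have "{xs \<in> D. Q xs n} = ?top \<union> ?oth" by auto
    then have "card {xs \<in> D. Q xs n} = card ?top + card ?oth"
      using finD by (simp only:) (rule card_Un_disjoint, auto)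
    ultimately show ?thesis using IH by simp
  qed
  have "(\<Sum>xs\<in>D. card {j. j < Suc n \<and> Q xs j}) = (\<Sum>j<Suc n. card {xs \<in> D. Q xs j})"
  proof -
    have "(\<Sum>xs\<in>D. card {j. j < Suc n \<and> Q xs j}) = (\<Sum>xs\<in>D. \<Sum>j | j \<in> {..<Suc n} \<and> Q xs j. 1)"
      by simp
    also have "\<dots> = (\<Sum>j<Suc n. \<Sum>xs | xs \<in> D \<and> Q xs j. 1)"
      by (rule sum.swap_restrict) (use finD in auto)
    finally show ?thesis by simp
  qed
  moreover have "even (\<Sum>j<n. card {xs \<in> D. Q xs j})"
    using col by (intro dvd_sum) auto
  ultimately have "odd (\<Sum>xs\<in>D. card {j. j < Suc n \<and> Q xs j})"
    using last_col by simp
  then have "odd (card {xs \<in> D. alt2 xs})"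
    using finD row by (simp add: even_sum_iff cong: conj_cong)
  moreover have "card {xs \<in> D. alt2 xs}
    = card {xs \<in> signed_perms (Suc n). alternating True (prefix_values s xs)}"
  proof -
    let ?P = "{xs \<in> signed_perms (Suc n). alternating True (prefix_values s xs)}"
    let ?N = "{xs \<in> signed_perms (Suc n). (n, True) \<in> set xs \<and> alternating False (prefix_values s xs)}"
    let ?PT = "{xs \<in> ?P. (n, True) \<in> set xs}"
    let ?PF = "{xs \<in> ?P. (n, True) \<notin> set xs}"
    have neg: "prefix_values s (map (apsnd Not) xs) = map Not (prefix_values s xs)"
      if "xs \<in> signed_perms (Suc n)" for xs
    proof -
      have "s (flip (set (take (Suc i) xs))) \<longleftrightarrow> \<not> s (set (take (Suc i) xs))" if "i < length xs" for i
      proof (rule Suc.prems)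
        show "set (take (Suc i) xs) \<noteq> {}" using that by auto
        have "inj_on fst (set xs)" "fst ` set xs = {..<Suc n}"
          using \<open>xs \<in> signed_perms (Suc n)\<close> by (auto simp: signed_perms_def distinct_map)
        then show "inj_on fst (set (take (Suc i) xs))" "fst ` set (take (Suc i) xs) \<subseteq> {..<Suc n}"
          by (meson inj_on_subset set_take_subset, metis image_mono set_take_subset)
      qed
      then show ?thesis by (auto simp: prefix_values_def take_map)
    qed
    have mem: "(n, True) \<in> set (map (apsnd Not) xs) \<longleftrightarrow> (n, True) \<notin> set xs"
      if "xs \<in> signed_perms (Suc n)" for xs
    proof -
      have i: "inj_on fst (set xs)" and r: "n \<in> fst ` set xs"
        using that by (auto simp: signed_perms_def distinct_map)
      from r obtain b where b: "(n, b) \<in> set xs" by auto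
      have "(n, True) \<in> set (map (apsnd Not) xs) \<longleftrightarrow> (n, False) \<in> set xs"
        by (force simp: image_iff)
      moreover have "(n, c) \<in> set xs \<longleftrightarrow> c = b" for c
        using inj_onD[OF i, of "(n, c)" "(n, b)"] b by auto
      ultimately show ?thesis by auto
    qed
    have inv: "map (apsnd Not) (map (apsnd Not) xs) = xs" for xs :: "(nat \<times> bool) list"
      by (induction xs) (simp_all add: prod_eq_iff)
    \<comment> \<open>The antipodal map turns the chains of \<open>D\<close> that begin with \<open>False\<close> into the chains outside
      \<open>D\<close> that begin with \<open>True\<close>.\<close>
    have "bij_betw (map (apsnd Not)) ?N ?PF"
      by (rule bij_betwI[where g = "map (apsnd Not)"])
        (auto simp: neg mem map_flip_signed_perm alternating_map_Not inv simp del: map_map set_map)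
    then have "card ?N = card ?PF" by (rule bij_betw_same_card)
    moreover have "?PT \<inter> ?N = {}"
    proof -
      have "\<not> (alternating True ys \<and> alternating False ys)" if "ys \<noteq> []" for ys
        using that by (cases ys) auto
      moreover have "prefix_values s xs \<noteq> []" if "xs \<in> signed_perms (Suc n)" for xs
        using length_signed_perm[OF that] by (auto simp flip: length_0_conv)
      ultimately show ?thesis by blast
    qed
    ultimately have "card (?PT \<union> ?N) = card ?PT + card ?PF"
      by (simp add: card_Un_disjoint)
    also have "\<dots> = card (?PT \<union> ?PF)"
      by (subst card_Un_disjoint) auto
    also have "?PT \<union> ?PF = ?P" by auto
    also have "?PT \<union> ?N = {xs \<in> D. alt2 xs}" by (auto simp: D_def alt2_def)
    finally show ?thesis .
  qed
  ultimately show ?case by simp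
qed

section \<open>Colouring sets with few gaps\<close>

definition signed_set :: "nat \<Rightarrow> (nat \<times> bool) set \<Rightarrow> bool" where
  "signed_set n X \<longleftrightarrow> inj_on fst X \<and> fst ` X \<subseteq> {..<n}"

lemma alternating_nth_Suc:
  "alternating b xs \<Longrightarrow> Suc i < length xs \<Longrightarrow> xs ! Suc i \<longleftrightarrow> \<not> xs ! i"
proof (induction xs arbitrary: b i)
  case (Cons x xs)
  then show ?case by (cases i; cases xs) auto
qed simp

text \<open>
  A monotone form of Tucker's lemma. Let the sign of \<open>X\<close> be the side on which \<open>r X\<close> is larger.
  Along a chain whose signs alternate, the larger value increases strictly: at each step the side
  that was ahead is overtaken without having lost anything. A full chain has \<open>n\<close> steps.
\<close>
lemma monotone_tucker:
  fixes r :: "(nat \<times> bool) set \<Rightarrow> bool \<Rightarrow> nat"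
  assumes mono: "\<And>X Y b. \<lbrakk>signed_set n Y; X \<subseteq> Y\<rbrakk> \<Longrightarrow> r X b \<le> r Y b"
    and flip: "\<And>X b. signed_set n X \<Longrightarrow> r (flip X) b = r X (\<not> b)"
    and neq: "\<And>X. \<lbrakk>signed_set n X; X \<noteq> {}\<rbrakk> \<Longrightarrow> r X True \<noteq> r X False"
  shows "\<exists>X b. signed_set n X \<and> n \<le> r X b"
proof (cases n)
  case 0
  then show ?thesis by (intro exI[of _ "{}"]) (simp add: signed_set_def)
next
  case (Suc k)
  define s where "s X \<longleftrightarrow> r X False < r X True" for X
  have "odd (card {xs \<in> signed_perms n. alternating True (prefix_values s xs)})"
  proof (rule odd_card_alternating_signed_perms)
    fix X :: "(nat \<times> bool) set"
    assume "X \<noteq> {}" "inj_on fst X" "fst ` X \<subseteq> {..<n}"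
    then show "s (flip X) \<longleftrightarrow> \<not> s X"
      using flip[of X] neq[of X] by (auto simp: s_def signed_set_def)
  qed
  then obtain xs where xs: "xs \<in> signed_perms n" and alt: "alternating True (prefix_values s xs)"
    by (metis (no_types, lifting) card.empty empty_Collect_eq even_zero)
  have len: "length xs = n" using xs by (rule length_signed_perm)
  define P where "P i = set (take (Suc i) xs)" for i
  have "signed_set n (set xs)"
    using xs by (auto simp: signed_perms_def signed_set_def distinct_map)
  then have P: "signed_set n (P i)" for i
    unfolding signed_set_def P_def
    by (meson image_mono inj_on_subset order_trans set_take_subset)
  have P_ne: "P i \<noteq> {}" for i
    using len Suc by (auto simp: P_def)
  have big: "r (P i) (\<not> s (P i)) < r (P i) (s (P i))" for i
    using neq[OF P P_ne, of i] by (cases "r (P i) False < r (P i) True") (auto simp: s_def)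
  have step: "s (P (Suc i)) \<longleftrightarrow> \<not> s (P i)" if "Suc i < n" for i
    using alternating_nth_Suc[OF alt, of i] that len by (simp add: prefix_values_def P_def)
  have "Suc i \<le> r (P i) (s (P i))" if "i < n" for i
    using that
  proof (induction i)
    case 0
    then show ?case using big[of 0] by simp
  next
    case (Suc i)
    then have "Suc i \<le> r (P i) (s (P i))" by simp
    also have "\<dots> \<le> r (P (Suc i)) (s (P i))"
      by (rule mono[OF P]) (simp add: P_def set_take_subset_set_take)
    also have "\<dots> < r (P (Suc i)) (s (P (Suc i)))"
      using big[of "Suc i"] step[of i] Suc.prems by simp
    finally show ?case by simp
  qed
  from this[of k] show ?thesis using P Suc by auto
qed

definition path_stable :: "nat set \<Rightarrow> bool" where
  "path_stable A \<longleftrightarrow> (\<forall>a\<in>A. Suc a \<notin> A)"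

definition gaps :: "nat \<Rightarrow> nat set \<Rightarrow> nat set" where
  "gaps m A = {s. s < m \<and> s \<notin> A \<and> Suc s \<notin> A}"

text \<open>
  Under disjointness these sets form a graph that resembles a Schrijver graph: it is the Kneser
  graph of nearly largest stable sets of a path, where the number of gaps bounds the deviation
  from a largest one. Adjacent sets \<open>A\<close>, \<open>B\<close> that have no gap at \<open>s\<close> split \<open>s\<close> and \<open>Suc s\<close> between
  them, so the sets without a gap at \<open>s\<close> induce a bipartite graph.
\<close>
definition sparse_gap_sets :: "nat \<Rightarrow> nat \<Rightarrow> nat set set" where
  "sparse_gap_sets m d = {A. A \<subseteq> {..m} \<and> path_stable A \<and> card (gaps m A) \<le> d}"

lemma card_gaps_le:
  assumes "path_stable A" "A \<subseteq> {..m}"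
  shows "card (gaps m A) + 2 * card A \<le> m + 2"
proof -
  have fin: "finite A" by (rule finite_subset[OF assms(2)]) simp
  let ?L = "A \<inter> {..<m}" and ?R = "{s. s < m \<and> Suc s \<in> A}"
  have "A \<subseteq> insert m ?L" using assms(2) by auto
  then have L: "card A \<le> Suc (card ?L)"
    using card_mono[of "insert m ?L" A] fin by (simp add: card_insert_if)
  have "A \<subseteq> insert 0 (Suc ` ?R)"
  proof
    fix a assume "a \<in> A"
    then show "a \<in> insert 0 (Suc ` ?R)" using assms(2) by (cases a) auto
  qed
  then have "card A \<le> card (insert 0 (Suc ` ?R))" by (intro card_mono) auto
  also have "\<dots> = Suc (card ?R)" by (simp add: card_image)
  finally have R: "card A \<le> Suc (card ?R)" .
  have "card (gaps m A) + card ?L + card ?R = card (gaps m A \<union> ?L \<union> ?R)"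
    using assms(1) fin
    by (subst card_Un_disjoint; (subst card_Un_disjoint)?) (auto simp: gaps_def path_stable_def)
  also have "\<dots> \<le> card {..<m}"
    by (intro card_mono) (auto simp: gaps_def)
  finally show ?thesis using L R by simp
qed

text \<open>
  The length of a longest alternating sequence of signs in \<open>X\<close>, restricted to the indices below \<open>j\<close>,
  that ends in \<open>b\<close>. For a sign vector, reading another \<open>b\<close> can extend only the sequences that end in
  the opposite sign.
\<close>
fun alt_len :: "(nat \<times> bool) set \<Rightarrow> bool \<Rightarrow> nat \<Rightarrow> nat" where
  "alt_len X b 0 = 0"
| "alt_len X b (Suc j) = (if (j, b) \<in> X then Suc (alt_len X (\<not> b) j) else alt_len X b j)"

abbreviation side :: "(nat \<times> bool) set \<Rightarrow> bool \<Rightarrow> nat set" where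
  "side X b \<equiv> {i. (i, b) \<in> X}"

lemma signed_set_one_sign: "signed_set n X \<Longrightarrow> (i, b) \<in> X \<Longrightarrow> (i, \<not> b) \<notin> X"
  unfolding signed_set_def by (metis fst_conv inj_onD prod.inject)

lemma alt_len_le: "alt_len X b j \<le> Suc (alt_len X (\<not> b) j)"
proof (induction j arbitrary: b)
  case (Suc j)
  then show ?case using Suc.IH[of b] Suc.IH[of "\<not> b"] by auto
qed simp

lemma alt_len_mono: "X \<subseteq> Y \<Longrightarrow> alt_len X b j \<le> alt_len Y b j"
proof (induction j arbitrary: b)
  case (Suc j)
  have "alt_len X b j \<le> Suc (alt_len Y (\<not> b) j)"
    using Suc alt_len_le[of Y b j] by (meson order_trans)
  with Suc show ?case by auto
qed simp

lemma mem_flip_iff: "(i, b) \<in> flip X \<longleftrightarrow> (i, \<not> b) \<in> X"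
  by (force simp: image_iff)

lemma alt_len_flip: "alt_len (flip X) b j = alt_len X (\<not> b) j"
  by (induction j arbitrary: b) (auto simp: mem_flip_iff)

text \<open>
  The final nonzero sign decides: just after it has been read, its own side is ahead by one.
\<close>
lemma alt_len_sides_neq:
  assumes "signed_set n X" "(i, c) \<in> X" "i < j"
  shows "alt_len X b j \<noteq> alt_len X (\<not> b) j"
  using assms(3)
proof (induction j arbitrary: b)
  case (Suc j)
  note one = signed_set_one_sign[OF assms(1)]
  show ?case
  proof (cases "(j, b) \<in> X \<or> (j, \<not> b) \<in> X")
    case True
    then show ?thesis
      using one[of j b] one[of j "\<not> b"] alt_len_le[of X b j] alt_len_le[of X "\<not> b" j] by auto
  next
    case False
    then have "i \<noteq> j" using assms(2) by (cases "c = b") auto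
    then show ?thesis using Suc False by auto
  qed
qed simp

text \<open>
  Every other element of an alternating sequence has sign \<open>b\<close>, and elements of the opposite sign
  separate them. The second claim concerns the sequences that end in the opposite sign; their
  elements of sign \<open>b\<close> stay away from \<open>j\<close>, so that \<open>j\<close> may be added next. This makes the induction
  work.
\<close>
lemma ex_path_stable_of_alt_len:
  assumes "signed_set n X"
  shows "\<exists>A \<subseteq> side X b \<inter> {..<j}. path_stable A \<and> alt_len X b j \<le> 2 * card A"
    and "\<exists>A \<subseteq> side X b. path_stable A \<and> (\<forall>a\<in>A. Suc a < j) \<and> alt_len X (\<not> b) j \<le> Suc (2 * card A)"
proof (induction j)
  case 0
  {
    case 1
    show ?case by (intro exI[of _ "{}"]) (simp add: path_stable_def)
  next
    case 2
    show ?case by (intro exI[of _ "{}"]) (simp add: path_stable_def)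
  }
next
  case (Suc j)
  obtain A where A: "A \<subseteq> side X b \<inter> {..<j}" "path_stable A" "alt_len X b j \<le> 2 * card A"
    using Suc(1) by blast
  obtain B where B: "B \<subseteq> side X b" "path_stable B" "\<forall>a\<in>B. Suc a < j"
      "alt_len X (\<not> b) j \<le> Suc (2 * card B)"
    using Suc(2) by blast
  {
    case 1
    show ?case
    proof (cases "(j, b) \<in> X")
      case True
      have "B \<subseteq> {..<j}" using B(3) by auto
      then have "finite B" using finite_subset by blast
      then have "card (insert j B) = Suc (card B)" using B(3) by (subst card_insert_disjoint) auto
      moreover have "path_stable (insert j B)" using B(2,3) unfolding path_stable_def by auto
      ultimately show ?thesis
        using True B by (intro exI[of _ "insert j B"]) auto
    next
      case False
      then show ?thesis using A by (intro exI[of _ A]) auto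
    qed
  next
    case 2
    show ?case
    proof (cases "(j, \<not> b) \<in> X")
      case True
      then show ?thesis using A by (intro exI[of _ A]) auto
    next
      case False
      then show ?thesis using B by (intro exI[of _ B]) auto
    qed
  }
qed

lemma finite_sparse_gap_sets: "finite (sparse_gap_sets m d)"
  unfolding sparse_gap_sets_def by (rule finite_subset[of _ "Pow {..m}"]) auto

text \<open>
  This is Matousek's deduction of Kneser's conjecture from Tucker's lemma, adapted to
  \<open>monotone_tucker\<close>. Each side of a sign vector is rated by the largest colour of a vertex contained
  in it, or, below all colours, by \<open>alt_len\<close> if it contains no vertex. Both sides cannot have the same
  largest colour, because vertices inside different sides are disjoint, hence adjacent. A side
  without a vertex has \<open>alt_len\<close> at most \<open>n - d\<close>, where \<open>n = Suc m\<close>, as otherwise it would contain a stable set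
  so large that it has at most \<open>d\<close> gaps. Hence the ratings are at most \<open>n - d + C\<close>, while one of
  them is at least \<open>n\<close>.
\<close>
lemma sparse_gap_sets_colours_ge:
  fixes c :: "nat set \<Rightarrow> nat"
  assumes "d \<le> m"
    and less: "\<And>A. A \<in> sparse_gap_sets m d \<Longrightarrow> c A < C"
    and proper: "\<And>A B. \<lbrakk>A \<in> sparse_gap_sets m d; B \<in> sparse_gap_sets m d; A \<inter> B = {}\<rbrakk> \<Longrightarrow> c A \<noteq> c B"
  shows "d \<le> C"
proof -
  define n where "n = Suc m"
  define col where "col X b = c ` {A \<in> sparse_gap_sets m d. A \<subseteq> side X b}" for X b
  define r where "r X b = (if col X b = {} then alt_len X b n else Suc (n - d) + Max (col X b))" for X b
  have fin: "finite (col X b)" for X b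
    by (simp add: col_def finite_sparse_gap_sets)
  have col_less: "Max (col X b) < C" if "col X b \<noteq> {}" for X b
    using Max_in[OF fin that] less by (auto simp: col_def)
  have small: "alt_len X b n \<le> n - d" if X: "signed_set n X" and "col X b = {}" for X b
  proof (rule ccontr)
    assume "\<not> alt_len X b n \<le> n - d"
    moreover obtain A where A: "A \<subseteq> side X b \<inter> {..<n}" "path_stable A" "alt_len X b n \<le> 2 * card A"
      using ex_path_stable_of_alt_len(1)[OF X] by blast
    moreover have "A \<subseteq> {..m}" using A(1) by (auto simp: n_def)
    ultimately have "A \<in> sparse_gap_sets m d"
      using card_gaps_le[of A m] \<open>d \<le> m\<close> by (auto simp: sparse_gap_sets_def n_def)
    with A(1) show False using \<open>col X b = {}\<close> by (auto simp: col_def)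
  qed
  have "\<exists>X b. signed_set n X \<and> n \<le> r X b"
  proof (rule monotone_tucker)
    fix X Y b assume Y: "signed_set n Y" and XY: "X \<subseteq> Y"
    then have X: "signed_set n X" by (auto simp: signed_set_def inj_on_subset)
    have sub: "col X b \<subseteq> col Y b" using XY by (auto simp: col_def)
    then have "Max (col X b) \<le> Max (col Y b)" if "col X b \<noteq> {}"
      using that fin by (intro Max_mono) auto
    then show "r X b \<le> r Y b"
      using alt_len_mono[OF XY, of b n] small[OF X, of b] sub by (auto simp: r_def)
  next
    fix X b
    have "col (flip X) b = col X (\<not> b)" by (simp add: col_def mem_flip_iff)
    then show "r (flip X) b = r X (\<not> b)" by (simp add: r_def alt_len_flip)
  next
    fix X assume X: "signed_set n X" and "X \<noteq> {}"
    then obtain i b where i: "(i, b) \<in> X" by fast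
    then have "i < n" using X by (auto simp: signed_set_def)
    have "Max (col X True) \<noteq> Max (col X False)" if ne: "col X True \<noteq> {}" "col X False \<noteq> {}"
    proof -
      obtain A B where "Max (col X True) = c A" "A \<in> sparse_gap_sets m d" "A \<subseteq> side X True"
        "Max (col X False) = c B" "B \<in> sparse_gap_sets m d" "B \<subseteq> side X False"
        using Max_in[OF fin ne(1)] Max_in[OF fin ne(2)] unfolding col_def by auto
      moreover have "side X True \<inter> side X False = {}"
        using signed_set_one_sign[OF X, of _ True] by auto
      ultimately show ?thesis using proper[of A B] by auto
    qed
    then show "r X True \<noteq> r X False"
      using alt_len_sides_neq[OF X i \<open>i < n\<close>, of True] small[OF X, of True] small[OF X, of False]
      by (auto simp: r_def)
  qed
  then obtain X b where X: "signed_set n X" and "n \<le> r X b" by blast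
  moreover have "r X b \<le> n - d + C"
    using small[OF X, of b] col_less[of X b] by (cases "col X b = {}") (simp_all add: r_def)
  ultimately show ?thesis using \<open>d \<le> m\<close> by (simp add: n_def)
qed

text \<open>
  A set of at most \<open>d\<close> elements is named by \<open>d\<close> choices from \<open>{..m}\<close>, where choosing \<open>m\<close> adds
  nothing.
\<close>
lemma card_small_subsets_le: "card {F. F \<subseteq> {..<m} \<and> card F \<le> d} \<le> Suc m ^ d" for m d :: nat
proof (induction d)
  case 0
  have "{F. F \<subseteq> {..<m} \<and> card F \<le> 0} = {{}}" by (auto dest: finite_subset)
  then show ?case by simp
next
  case (Suc d)
  let ?S = "\<lambda>d. {F. F \<subseteq> {..<m} \<and> card F \<le> d}"
  let ?add = "\<lambda>(F, x). if x = m then F else insert x F"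
  have fin: "finite (?S d)" by (rule finite_subset[of _ "Pow {..<m}"]) auto
  have "?S (Suc d) \<subseteq> ?add ` (?S d \<times> {..m})"
  proof
    fix F assume F: "F \<in> ?S (Suc d)"
    then have finF: "finite F" by (auto dest: finite_subset)
    show "F \<in> ?add ` (?S d \<times> {..m})"
    proof (cases "card F \<le> d")
      case True
      then show ?thesis using F by (intro image_eqI[of _ _ "(F, m)"]) auto
    next
      case False
      then obtain x where x: "x \<in> F" by fastforce
      then have "card (F - {x}) \<le> d" using F finF by auto
      then show ?thesis using F x by (intro image_eqI[of _ _ "(F - {x}, x)"]) auto
    qed
  qed
  then have "card (?S (Suc d)) \<le> card (?S d \<times> {..m})"
    by (rule surj_card_le[rotated]) (use fin in simp)
  also have "\<dots> \<le> Suc m ^ d * Suc m"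
    unfolding card_cartesian_product card_atMost by (rule mult_right_mono[OF Suc.IH]) simp
  finally show ?case by (simp add: mult.commute)
qed

text \<open>
  A path-stable set is determined by its gaps and its behaviour at \<open>0\<close>: moving along the path, membership
  changes at every step unless there is a gap.
\<close>
lemma card_sparse_gap_sets_le: "card (sparse_gap_sets m d) \<le> 2 * Suc m ^ d"
proof -
  let ?S = "{F. F \<subseteq> {..<m} \<and> card F \<le> d}"
  have "inj_on (\<lambda>A. (0 \<in> A, gaps m A)) (sparse_gap_sets m d)"
  proof (rule inj_onI)
    fix A B assume A: "A \<in> sparse_gap_sets m d" and B: "B \<in> sparse_gap_sets m d"
      and eq: "(0 \<in> A, gaps m A) = (0 \<in> B, gaps m B)"
    have "i \<le> m \<Longrightarrow> i \<in> A \<longleftrightarrow> i \<in> B" for i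
    proof (induction i)
      case (Suc i)
      have "Suc i \<in> C \<longleftrightarrow> i \<notin> C \<and> i \<notin> gaps m C" if "C \<in> sparse_gap_sets m d" for C
        using that Suc.prems by (auto simp: sparse_gap_sets_def path_stable_def gaps_def)
      from this[OF A] this[OF B] show ?case using Suc eq by simp
    qed (use eq in simp)
    moreover have "A \<subseteq> {..m}" "B \<subseteq> {..m}" using A B by (auto simp: sparse_gap_sets_def)
    ultimately show "A = B" by blast
  qed
  moreover have "(\<lambda>A. (0 \<in> A, gaps m A)) ` sparse_gap_sets m d \<subseteq> UNIV \<times> ?S"
    by (auto simp: sparse_gap_sets_def gaps_def)
  moreover have "finite ?S" by (rule finite_subset[of _ "Pow {..<m}"]) auto
  ultimately have "card (sparse_gap_sets m d) \<le> card ((UNIV :: bool set) \<times> ?S)"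
    by (intro card_inj_on_le) auto
  also have "\<dots> \<le> 2 * Suc m ^ d"
    using card_small_subsets_le[of m d] by (simp add: card_cartesian_product)
  finally show ?thesis .
qed

section \<open>Orientations in which every small set is dominated\<close>

lemma card_sets_avoiding_trace:
  assumes "finite S" "W \<subseteq> S" "D \<subseteq> W"
  shows "card {A \<in> Pow S. A \<inter> W \<noteq> D} = 2 ^ (card S - card W) * (2 ^ card W - 1)"
proof -
  have "bij_betw (\<lambda>B. B \<union> D) (Pow (S - W)) {A \<in> Pow S. A \<inter> W = D}"
    by (rule bij_betwI[where g = "\<lambda>A. A - W"]) (use assms in auto)
  moreover have finW: "finite W" using assms by (meson finite_subset)
  ultimately have "card {A \<in> Pow S. A \<inter> W = D} = 2 ^ (card S - card W)"
    using assms by (simp add: bij_betw_same_card[symmetric] card_Pow card_Diff_subset)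
  moreover have "{A \<in> Pow S. A \<inter> W \<noteq> D} = Pow S - {A \<in> Pow S. A \<inter> W = D}" by auto
  ultimately have "card {A \<in> Pow S. A \<inter> W \<noteq> D} = 2 ^ card S - 2 ^ (card S - card W)"
    using assms by (simp only:) (subst card_Diff_subset, auto simp: card_Pow)
  also have "(2 :: nat) ^ card S = 2 ^ (card S - card W) * 2 ^ card W"
    using assms by (simp add: card_mono flip: power_add)
  finally show ?thesis by (simp add: diff_mult_distrib2)
qed

text \<open>
  Erdos's random tournament, as a counting argument. A random set \<open>f s\<close> is chosen independently for each
  vertex \<open>s\<close>, and \<open>s\<close> against \<open>t\<close> is decided by comparing whether \<open>t \<in> f s\<close> and \<open>s \<in> f t\<close>. Once
  the sets of the members of \<open>W\<close> are fixed, a vertex \<open>s\<close> outside \<open>W\<close> dominates \<open>W\<close> for exactly one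
  trace of \<open>f s\<close> on \<open>W\<close>, independently for different \<open>s\<close>. So all of them fail with probability
  \<open>(1 - 1/2^q)^(m - q)\<close>, and the union bound over \<open>W\<close> applies.
\<close>
lemma ex_dominating_orientation:
  assumes "q \<le> m" and count: "(m choose q) * (2 ^ q - 1) ^ (m - q) < (2 ^ q) ^ (m - q)"
  shows "\<exists>beats :: nat \<Rightarrow> nat \<Rightarrow> bool. (\<forall>s t. beats s t \<longrightarrow> \<not> beats t s) \<and>
    (\<forall>W \<subseteq> {..<m}. card W \<le> q \<longrightarrow> (\<exists>s<m. \<forall>w\<in>W. beats s w))"
proof -
  define Fn where "Fn = ({..<m} \<rightarrow>\<^sub>E Pow {..<m})"
  define beats where "beats f s t \<longleftrightarrow>
    s \<noteq> t \<and> (if s < t then t \<in> f s \<longleftrightarrow> s \<in> f t else t \<in> f s \<longleftrightarrow> s \<notin> f t)"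
    for f :: "nat \<Rightarrow> nat set" and s t :: nat
  define trace where "trace W f s = {w \<in> W. if s < w then s \<in> f w else s \<notin> f w}"
    for W and f :: "nat \<Rightarrow> nat set" and s :: nat
  have asym: "beats f s t \<Longrightarrow> \<not> beats f t s" for f s t
    by (auto simp: beats_def split: if_splits)
  have beats_all: "\<forall>w\<in>W. beats f s w" if "f s \<inter> W = trace W f s" "s \<notin> W" for f s W
  proof
    fix w assume "w \<in> W"
    moreover have "w \<in> f s \<inter> W \<longleftrightarrow> w \<in> trace W f s" using that(1) by simp
    ultimately show "beats f s w"
      using that(2) by (cases "s < w") (auto simp: beats_def trace_def)
  qed
  define Ws where "Ws = {W. W \<subseteq> {..<m} \<and> card W = q}"
  define Bad where "Bad W = {f \<in> Fn. \<forall>s\<in>{..<m} - W. f s \<inter> W \<noteq> trace W f s}" for W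
  have finFn: "finite Fn" by (simp add: Fn_def finite_PiE)
  have card_Bad: "card (Bad W) \<le> (2 ^ m) ^ q * (2 ^ (m - q) * (2 ^ q - 1)) ^ (m - q)"
    if "W \<in> Ws" for W
  proof -
    have W: "W \<subseteq> {..<m}" "card W = q" using that by (auto simp: Ws_def)
    then have finW: "finite W" using finite_subset by blast
    let ?R = "{..<m} - W"
    let ?rest = "\<lambda>g. PiE ?R (\<lambda>s. {A \<in> Pow {..<m}. A \<inter> W \<noteq> trace W g s})"
    let ?split = "\<lambda>f. (restrict f W, restrict f ?R)"
    have "inj_on ?split (Bad W)"
    proof (rule inj_onI)
      fix f f' assume f: "f \<in> Bad W" "f' \<in> Bad W" and eq: "?split f = ?split f'"
      show "f = f'"
      proof (rule PiE_ext)
        show "f \<in> {..<m} \<rightarrow>\<^sub>E Pow {..<m}" "f' \<in> {..<m} \<rightarrow>\<^sub>E Pow {..<m}"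
          using f by (auto simp: Bad_def Fn_def)
        fix x assume "x \<in> {..<m}"
        moreover have "restrict f W x = restrict f' W x" "restrict f ?R x = restrict f' ?R x"
          using eq by simp_all
        ultimately show "f x = f' x" by (cases "x \<in> W") auto
      qed
    qed
    moreover have "?split ` Bad W \<subseteq> (SIGMA g : (W \<rightarrow>\<^sub>E Pow {..<m}). ?rest g)"
    proof
      fix p assume "p \<in> ?split ` Bad W"
      then obtain f where f: "f \<in> Bad W" and p: "p = ?split f" by blast
      have "trace W (restrict f W) s = trace W f s" for s by (auto simp: trace_def)
      with f W show "p \<in> (SIGMA g : (W \<rightarrow>\<^sub>E Pow {..<m}). ?rest g)"
        unfolding p Bad_def Fn_def by auto
    qed
    ultimately have "card (Bad W) \<le> card (SIGMA g : (W \<rightarrow>\<^sub>E Pow {..<m}). ?rest g)"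
      by (intro card_inj_on_le[of ?split]) (use finW in \<open>auto intro!: finite_SigmaI finite_PiE\<close>)
    also have "\<dots> = (\<Sum>g\<in>W \<rightarrow>\<^sub>E Pow {..<m}. card (?rest g))"
      using finW by (intro card_SigmaI) (auto intro!: finite_PiE)
    also have "\<dots> = (\<Sum>g\<in>W \<rightarrow>\<^sub>E Pow {..<m}. (2 ^ (m - q) * (2 ^ q - 1)) ^ (m - q))"
    proof (rule sum.cong[OF refl])
      fix g
      have "card {A \<in> Pow {..<m}. A \<inter> W \<noteq> trace W g s} = 2 ^ (m - q) * (2 ^ q - 1)" for s
        using card_sets_avoiding_trace[of "{..<m}" W "trace W g s"] W by (auto simp: trace_def)
      moreover have "card ?R = m - q" using W finW by (simp add: card_Diff_subset)
      ultimately show "card (?rest g) = (2 ^ (m - q) * (2 ^ q - 1)) ^ (m - q)"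
        by (simp add: card_PiE)
    qed
    also have "\<dots> = (2 ^ m) ^ q * (2 ^ (m - q) * (2 ^ q - 1)) ^ (m - q)"
      using finW W by (simp add: card_funcsetE card_Pow)
    finally show ?thesis .
  qed
  have finWs: "finite Ws" by (simp add: Ws_def)
  have "card (\<Union>W\<in>Ws. Bad W) \<le> (\<Sum>W\<in>Ws. card (Bad W))" by (rule card_UN_le[OF finWs])
  also have "\<dots> \<le> (\<Sum>W\<in>Ws. (2 ^ m) ^ q * (2 ^ (m - q) * (2 ^ q - 1)) ^ (m - q))"
    by (rule sum_mono) (rule card_Bad)
  also have "\<dots> = (2 ^ m) ^ q * (2 ^ (m - q)) ^ (m - q) * ((m choose q) * (2 ^ q - 1) ^ (m - q))"
    using n_subsets[of "{..<m}" q] by (simp add: Ws_def power_mult_distrib)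
  also have "\<dots> < (2 ^ m) ^ q * (2 ^ (m - q)) ^ (m - q) * (2 ^ q) ^ (m - q)"
    using count by simp
  also have "\<dots> = (2 ^ m) ^ q * (2 ^ (m - q) * 2 ^ q) ^ (m - q)"
    by (simp only: power_mult_distrib mult.assoc)
  also have "\<dots> = (2 ^ m) ^ q * (2 ^ m) ^ (m - q)"
    using \<open>q \<le> m\<close> by (simp flip: power_add)
  also have "\<dots> = (2 ^ m) ^ m"
    using \<open>q \<le> m\<close> by (simp flip: power_add)
  also have "\<dots> = card Fn" by (simp add: Fn_def card_funcsetE card_Pow)
  finally have "\<not> Fn \<subseteq> (\<Union>W\<in>Ws. Bad W)"
    using card_mono[of "\<Union>W\<in>Ws. Bad W" Fn] finWs finFn by (auto simp: Bad_def not_le)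
  then obtain f where f: "f \<in> Fn" "\<And>W. W \<in> Ws \<Longrightarrow> f \<notin> Bad W" by blast
  have "\<exists>s<m. \<forall>w\<in>W. beats f s w" if W: "W \<subseteq> {..<m}" "card W \<le> q" for W
  proof -
    have finW: "finite W" using W(1) finite_subset by blast
    have "q - card W \<le> card ({..<m} - W)"
      using W finW \<open>q \<le> m\<close> by (simp add: card_Diff_subset)
    then obtain Z where Z: "Z \<subseteq> {..<m} - W" "card Z = q - card W" "finite Z"
      by (rule obtain_subset_with_card_n)
    then have "card (W \<union> Z) = q"
      using finW W by (subst card_Un_disjoint) auto
    then have "W \<union> Z \<in> Ws" using W Z by (auto simp: Ws_def)
    then obtain s where "s < m" "s \<notin> W \<union> Z" "f s \<inter> (W \<union> Z) = trace (W \<union> Z) f s"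
      using f by (auto simp: Bad_def)
    then show ?thesis using beats_all[of f s "W \<union> Z"] by blast
  qed
  then show ?thesis using asym by (intro exI[of _ "beats f"]) blast
qed

text \<open>
  With \<open>m = 4 ^ q\<close> the union bound has at most \<open>m ^ q = 4 ^ (q\<^sup>2)\<close> terms, while each is about
  \<open>exp (- (2 ^ q))\<close>.
\<close>
lemma domination_count:
  fixes q :: nat
  assumes "8 \<le> q"
  shows "((4 ^ q) choose q) * (2 ^ q - 1) ^ (4 ^ q - q) < ((2 :: nat) ^ q) ^ (4 ^ q - q)"
proof -
  define m :: nat where "m = 4 ^ q"
  have "q < 2 ^ q" by (rule less_exp)
  also have "(2 :: nat) ^ q \<le> 4 ^ q" by (rule power_mono) auto
  finally have qm: "q \<le> m" by (simp add: m_def)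
  have "2 * q\<^sup>2 + 1 < (2 :: nat) ^ q"
    using assms
  proof (induction q rule: dec_induct)
    case (step n)
    have "8 * n \<le> n * n" using step by (intro mult_right_mono) auto
    moreover have "2 * (n * n) + 1 < 2 ^ n" using step.IH by (simp only: power2_eq_square)
    moreover have "2 * (x + 2 * n + 1) + 1 < 2 * y" if "8 * n \<le> x" "2 * x + 1 < y" for x y :: nat
      using that by presburger
    ultimately have "2 * (n * n + 2 * n + 1) + 1 < 2 * (2 :: nat) ^ n" by blast
    then show ?case by (simp add: power2_eq_square algebra_simps)
  qed simp
  then have "real (2 * q\<^sup>2 + 1) < real (2 ^ q)" by (simp only: of_nat_less_iff)
  then have growth: "2 * (real q)\<^sup>2 + 1 < 2 ^ q" by simp
  have "real q / 2 ^ q < 1" using \<open>q < 2 ^ q\<close> by (simp add: less_imp_of_nat_less)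
  moreover have "real (m - q) / 2 ^ q = 2 ^ q - real q / 2 ^ q"
    using qm by (simp add: of_nat_diff diff_divide_distrib) (simp add: m_def flip: power_divide)
  ultimately have exponent: "2 * (real q)\<^sup>2 < real (m - q) / 2 ^ q" using growth by linarith
  have "(4 :: real) \<le> exp 2" using exp_lower_Taylor_quadratic[of 2] by simp
  then have "(4 :: real) ^ q\<^sup>2 \<le> exp 2 ^ q\<^sup>2" by (rule power_mono) simp
  then have four: "(4 :: real) ^ q\<^sup>2 \<le> exp (2 * (real q)\<^sup>2)"
    by (simp add: mult.commute flip: exp_of_nat_mult)
  have "real (m choose q) \<le> real (m ^ q)" using binomial_le_pow[OF qm] by simp
  also have "\<dots> = 4 ^ q\<^sup>2" by (simp add: m_def power2_eq_square flip: power_mult)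
  finally have choose: "real (m choose q) \<le> exp (2 * (real q)\<^sup>2)" using four by linarith
  have "(1 - 1 / 2 ^ q :: real) \<le> exp (- (1 / 2 ^ q))"
    using exp_ge_add_one_self[of "- (1 / 2 ^ q) :: real"] by simp
  then have "(1 - 1 / 2 ^ q :: real) ^ (m - q) \<le> exp (- (1 / 2 ^ q)) ^ (m - q)"
    by (rule power_mono) simp
  also have "\<dots> = exp (- (real (m - q) / 2 ^ q))"
    by (simp flip: exp_of_nat_mult)
  finally have "real (m choose q) * (1 - 1 / 2 ^ q) ^ (m - q)
      \<le> exp (2 * (real q)\<^sup>2) * exp (- (real (m - q) / 2 ^ q))"
    using choose by (intro mult_mono) auto
  also have "\<dots> < 1" using exponent by (simp flip: exp_add)
  finally have main: "real (m choose q) * (1 - 1 / 2 ^ q) ^ (m - q) < 1" .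
  have "real ((m choose q) * (2 ^ q - 1) ^ (m - q))
      = real (m choose q) * (1 - 1 / 2 ^ q) ^ (m - q) * (2 ^ q) ^ (m - q)"
    by (simp add: of_nat_diff mult.assoc left_diff_distrib flip: power_mult_distrib)
  also have "\<dots> < 1 * (2 ^ q) ^ (m - q)"
    using main by (intro mult_strict_right_mono) auto
  also have "\<dots> = real ((2 ^ q) ^ (m - q))" by simp
  finally show ?thesis unfolding m_def by (simp only: of_nat_less_iff)
qed

section \<open>The graph and the tournament\<close>

text \<open>
  Keep the edges among the first \<open>k\<close> classes of an optimal colouring. A colouring of what remains with
  fewer than \<open>k\<close> colours, together with the other classes, would beat the optimal one.
\<close>
lemma ex_subgraph_with_chromatic_number:
  assumes "pair_graph G" and "1 \<le> k" and k: "k \<le> chromatic_number (with_proj G)"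
  shows "\<exists>H. pair_graph H \<and> pverts H = pverts G \<and> parcs H \<subseteq> parcs G
    \<and> chromatic_number (with_proj H) = k"
proof -
  interpret G: pair_graph G by fact
  define C where "C = chromatic_number (with_proj G)"
  have least: "C \<le> j" if "proper_colouring (with_proj G) j c" for j c
    unfolding C_def chromatic_number_def by (rule Least_le) (use that in blast)
  have "\<exists>c. proper_colouring (with_proj G) C c"
    using chromatic_number_le_iff[of "with_proj G" C] G.fin_digraph_axioms G.loopfree_digraph_axioms
    by (simp add: C_def)
  then obtain c where c: "proper_colouring (with_proj G) C c" by blast
  define H where "H = \<lparr>pverts = pverts G, parcs = {(u, v) \<in> parcs G. c u < k \<and> c v < k}\<rparr>"
  have vH [simp]: "pverts H = pverts G" and aH: "(u, v) \<in> parcs H \<longleftrightarrow> (u, v) \<in> parcs G \<and> c u < k \<and> c v < k" for u v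
    by (simp_all add: H_def)
  have sub: "parcs H \<subseteq> parcs G" by (auto simp: H_def)
  have no_loop: "(v, v) \<notin> parcs G" for v using G.pair_no_loops by force
  have "pair_graph H"
  proof
    show "finite (parcs H)" using sub G.pair_finite_arcs finite_subset by blast
    show "symmetric (with_proj H)"
      using G.pair_sym_arcs by (auto simp: symmetric_def sym_def aH)
  qed (auto simp: aH G.pair_finite_verts no_loop dest: G.in_arcsD1 G.in_arcsD2)
  moreover have "chromatic_number (with_proj H) = k"
    unfolding chromatic_number_def
  proof (rule Least_equality)
    show "\<exists>c'. proper_colouring (with_proj H) k c'"
    proof
      show "proper_colouring (with_proj H) k (\<lambda>v. if c v < k then c v else 0)"
        using c \<open>1 \<le> k\<close> by (auto simp: proper_colouring_def aH)
    qed
  next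
    fix j assume "\<exists>c'. proper_colouring (with_proj H) j c'"
    then obtain c' where c': "proper_colouring (with_proj H) j c'" by blast
    have "proper_colouring (with_proj G) (j + (C - k)) (\<lambda>v. if c v < k then c' v else j + (c v - k))"
      unfolding proper_colouring_def
    proof (intro conjI ballI allI impI)
      fix v assume "v \<in> verts (with_proj G)"
      then show "(if c v < k then c' v else j + (c v - k)) < j + (C - k)"
        using c c' k by (auto simp: proper_colouring_def C_def[symmetric])
    next
      fix u v assume uv: "u \<rightarrow>\<^bsub>with_proj G\<^esub> v"
      then have "u \<in> pverts G" "v \<in> pverts G" using G.in_arcsD1 G.in_arcsD2 by auto
      then have "c' u < j" "c' v < j" using c' by (simp_all add: proper_colouring_def)
      moreover have "c u \<noteq> c v" using c uv by (simp add: proper_colouring_def)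
      moreover have "c' u \<noteq> c' v" if "c u < k" "c v < k"
        using c' uv that by (simp add: proper_colouring_def aH)
      ultimately show "(if c u < k then c' u else j + (c u - k)) \<noteq> (if c v < k then c' v else j + (c v - k))"
        by auto
    qed
    then show "k \<le> j" using least k C_def by fastforce
  qed
  ultimately show ?thesis using sub by auto
qed

text \<open>
  Let \<open>u\<close> point to \<open>v\<close> if some single label of \<open>u\<close> beats all labels of \<open>v\<close>. Two vertices cannot point
  to each other in this way, since the two witnesses would beat each other; the remaining
  pairs are oriented arbitrarily. A label that beats all labels occurring in \<open>U\<close> then makes every
  vertex that carries it an in-neighbour of all of \<open>U\<close>.
\<close>
lemma ex_tournament_from_labels:
  fixes F :: "'a :: linorder \<Rightarrow> 'b set"
  assumes "finite V" and asym: "\<And>s t. beats s t \<Longrightarrow> \<not> beats t s"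
  shows "\<exists>T. pair_tournament T \<and> pverts T = V \<and>
    (\<forall>U s v. (\<forall>u\<in>U. \<forall>t\<in>F u. beats s t) \<longrightarrow> v \<in> out_nbrs_set (with_proj T) U \<longrightarrow> s \<notin> F v)"
proof -
  define dom where "dom u v \<longleftrightarrow> (\<exists>s\<in>F u. \<forall>t\<in>F v. beats s t)" for u v
  have dom_asym: "dom u v \<Longrightarrow> \<not> dom v u" for u v
    using asym unfolding dom_def by blast
  define T where "T = \<lparr>pverts = V,
    parcs = {(u, v). u \<in> V \<and> v \<in> V \<and> u \<noteq> v \<and> (dom u v \<or> \<not> dom v u \<and> u < v)}\<rparr>"
  have vT [simp]: "pverts T = V" by (simp add: T_def)
  have aT: "(u, v) \<in> parcs T \<longleftrightarrow> u \<in> V \<and> v \<in> V \<and> u \<noteq> v \<and> (dom u v \<or> \<not> dom v u \<and> u < v)" for u v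
    by (simp add: T_def)
  have "pair_tournament T"
  proof
    have "parcs T \<subseteq> V \<times> V" by (auto simp: aT)
    then show "finite (parcs T)" by (rule finite_subset) (simp add: \<open>finite V\<close>)
    fix u v assume "u \<in> pverts T" "v \<in> pverts T" "u \<noteq> v"
    then show "(u, v) \<in> parcs T \<longleftrightarrow> (v, u) \<notin> parcs T"
      using dom_asym by (auto simp: aT)
  qed (auto simp: aT \<open>finite V\<close>)
  moreover have "s \<notin> F v" if "\<forall>u\<in>U. \<forall>t\<in>F u. beats s t" "v \<in> out_nbrs_set (with_proj T) U" for U s v
  proof
    assume "s \<in> F v"
    from that(2) obtain u where u: "u \<in> U" "(u, v) \<in> parcs T"
      by (auto simp: out_nbrs_set_def out_nbrs_def)
    have "dom v u" using that(1) u(1) \<open>s \<in> F v\<close> by (auto simp: dom_def)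
    then show False using u(2) dom_asym by (auto simp: aT)
  qed
  ultimately show ?thesis using vT by blast
qed

lemma vertex_count_bound:
  assumes "8 \<le> K" "1 \<le> \<chi>"
  shows "2 * Suc (4 ^ (K * \<chi>)) ^ \<chi> \<le> (6 :: nat) ^ (\<chi>\<^sup>2 * K)"
proof -
  have five: "Suc (4 ^ n) \<le> 5 ^ n" if "1 \<le> n" for n :: nat
    using that by (induction n rule: dec_induct) auto
  have six: "2 * 5 ^ n \<le> (6 :: nat) ^ n" if "4 \<le> n" for n
    using that by (induction n rule: dec_induct) auto
  have "Suc (4 ^ (K * \<chi>)) ^ \<chi> \<le> (5 ^ (K * \<chi>)) ^ \<chi>"
    by (rule power_mono[OF five]) (use assms in auto)
  also have "\<dots> = 5 ^ (\<chi>\<^sup>2 * K)" by (simp add: power2_eq_square mult_ac flip: power_mult)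
  finally have "2 * Suc (4 ^ (K * \<chi>)) ^ \<chi> \<le> (2 * 5 ^ (\<chi>\<^sup>2 * K) :: nat)" by simp
  also have "\<dots> \<le> 6 ^ (\<chi>\<^sup>2 * K)"
  proof (rule six)
    have "1 * 4 \<le> \<chi>\<^sup>2 * K" using assms by (intro mult_mono) auto
    then show "4 \<le> \<chi>\<^sup>2 * K" by simp
  qed
  finally show ?thesis .
qed

theorem theorem2:
  fixes \<chi> :: nat
  assumes "\<chi> \<ge> 1"
  shows "\<forall>M. \<exists>N\<ge>M. N \<ge> 1 \<and>
    (\<exists>(V :: nat set) (G :: nat pair_pre_digraph) (T :: nat pair_pre_digraph).
       card V = N \<and>
       pair_graph G \<and> pverts G = V \<and>
       pair_tournament T \<and> pverts T = V \<and>
       chromatic_number (with_proj G) = \<chi> \<and>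
       (\<forall>U. U \<subseteq> V \<and> real (card U) \<le> ln (real N) / (2 * (real \<chi>)\<^sup>2) \<longrightarrow>
          chromatic_number (with_proj G \<restriction> out_nbrs_set (with_proj T) U) \<le> 2))"
proof
  fix M :: nat
  \<comment> \<open>\<open>K\<close> bounds the size of the sets \<open>U\<close>, so they carry at most \<open>q\<close> labels together. Since
    \<open>6 < exp 2\<close>, the choice of \<open>N\<close> makes \<open>ln N / (2 * \<chi>\<^sup>2)\<close> at most \<open>K\<close>.\<close>
  define K where "K = M + 8"
  define q where "q = K * \<chi>"
  define m :: nat where "m = 4 ^ q"
  define N :: nat where "N = 6 ^ (\<chi>\<^sup>2 * K)"
  define V where "V = {..<N}"
  have q8: "8 \<le> q" using mult_le_mono[of 8 K 1 \<chi>] assms by (simp add: q_def K_def)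
  have "\<chi> \<le> q" by (simp add: q_def K_def)
  have q_less: "q < m" unfolding m_def by (rule less_le_trans[OF less_exp power_mono]) auto
  have "M \<le> K" by (simp add: K_def)
  also have "K \<le> \<chi>\<^sup>2 * K" using assms by simp
  also have "\<chi>\<^sup>2 * K < N"
    unfolding N_def by (rule less_le_trans[OF less_exp power_mono]) auto
  finally have "M \<le> N" by simp

  define S where "S = sparse_gap_sets m \<chi>"
  define n where "n = card S"
  have finS: "finite S" by (simp add: S_def finite_sparse_gap_sets)
  have "n \<le> N"
    using card_sparse_gap_sets_le[of m \<chi>] vertex_count_bound[of K \<chi>] assms
    by (simp add: n_def S_def N_def m_def q_def K_def)
  obtain g where g: "bij_betw g {..<n} S"
    using ex_bij_betw_nat_finite[OF finS] by (auto simp: n_def atLeast0LessThan)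
  have gS: "g i \<in> S" if "i < n" for i using g that by (auto simp: bij_betw_def)
  \<comment> \<open>The numbers from \<open>n\<close> to \<open>N - 1\<close> are isolated vertices without labels, added to reach size \<open>N\<close>.\<close>
  define F where "F i = (if i < n then gaps m (g i) else {})" for i
  obtain beats :: "nat \<Rightarrow> nat \<Rightarrow> bool" where asym: "\<And>s t. beats s t \<Longrightarrow> \<not> beats t s"
    and dominated: "\<And>W. W \<subseteq> {..<m} \<Longrightarrow> card W \<le> q \<Longrightarrow> \<exists>s<m. \<forall>w\<in>W. beats s w"
    using ex_dominating_orientation[of q m] domination_count[OF q8] q_less unfolding m_def
    by (auto simp: less_imp_le)
  obtain T where T: "pair_tournament T" "pverts T = V"
    and out: "\<And>U s v. \<forall>u\<in>U. \<forall>t\<in>F u. beats s t \<Longrightarrow> v \<in> out_nbrs_set (with_proj T) U \<Longrightarrow> s \<notin> F v"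
    using ex_tournament_from_labels[of V beats F] asym by (auto simp: V_def)

  define G where "G = \<lparr>pverts = V, parcs = {(i, j). i < n \<and> j < n \<and> g i \<inter> g j = {}}\<rparr>"
  have vG [simp]: "pverts G = V" and aG: "(i, j) \<in> parcs G \<longleftrightarrow> i < n \<and> j < n \<and> g i \<inter> g j = {}" for i j
    by (simp_all add: G_def)
  have nonempty: "A \<noteq> {}" if "A \<in> S" for A
    using that q_less \<open>\<chi> \<le> q\<close> by (auto simp: S_def sparse_gap_sets_def gaps_def)
  have G: "pair_graph G"
  proof
    have "parcs G \<subseteq> V \<times> V" using \<open>n \<le> N\<close> by (auto simp: aG V_def)
    then show "finite (parcs G)" by (rule finite_subset) (simp add: V_def)
    show "symmetric (with_proj G)" by (auto simp: symmetric_def sym_def aG)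
  qed (use \<open>n \<le> N\<close> nonempty gS in \<open>auto simp: aG V_def\<close>)
  interpret G: pair_graph G by fact
  have "\<chi> \<le> chromatic_number (with_proj G)"
  proof -
    have "\<exists>c. proper_colouring (with_proj G) (chromatic_number (with_proj G)) c"
      using chromatic_number_le_iff[of "with_proj G"] G.fin_digraph_axioms G.loopfree_digraph_axioms
      by blast
    then obtain c where c: "proper_colouring (with_proj G) (chromatic_number (with_proj G)) c" by blast
    define h where "h = inv_into {..<n} g"
    have h: "h A < n" "g (h A) = A" if "A \<in> S" for A
      using that g bij_betw_inv_into_right[OF g] inv_into_into[of A g "{..<n}"]
      by (auto simp: h_def bij_betw_def)
    show ?thesis
    proof (rule sparse_gap_sets_colours_ge[where c = "c \<circ> h" and m = m])
      show "\<chi> \<le> m" using q_less \<open>\<chi> \<le> q\<close> by simp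
      fix A assume A: "A \<in> sparse_gap_sets m \<chi>"
      then have hA: "h A < n" "g (h A) = A" using h by (auto simp: S_def)
      then have "h A \<in> V" using \<open>n \<le> N\<close> by (simp add: V_def)
      then show "(c \<circ> h) A < chromatic_number (with_proj G)"
        using c by (simp add: proper_colouring_def)
      fix B assume "B \<in> sparse_gap_sets m \<chi>" "A \<inter> B = {}"
      then have "(h A, h B) \<in> parcs G" using h[of B] hA by (simp add: S_def aG)
      then show "(c \<circ> h) A \<noteq> (c \<circ> h) B"
        using c by (simp add: proper_colouring_def)
    qed
  qed
  then obtain H where H: "pair_graph H" "pverts H = V" "parcs H \<subseteq> parcs G"
    "chromatic_number (with_proj H) = \<chi>"
    using ex_subgraph_with_chromatic_number[OF G assms] by auto

  have two: "chromatic_number (with_proj H \<restriction> out_nbrs_set (with_proj T) U) \<le> 2"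
    if U: "U \<subseteq> V" "real (card U) \<le> ln (real N) / (2 * (real \<chi>)\<^sup>2)" for U
  proof -
    have "ln (6 :: real) \<le> 2"
    proof -
      have "(5 / 2 :: real) \<le> exp 1" using exp_lower_Taylor_quadratic[of 1] by simp
      then have "(5 / 2 :: real)\<^sup>2 \<le> (exp 1)\<^sup>2" by (rule power_mono) simp
      then have "(6 :: real) \<le> exp 2" by (simp add: power2_eq_square flip: exp_add)
      then show ?thesis using ln_le_cancel_iff[of 6 "exp 2"] by simp
    qed
    have "ln (real N) = (real \<chi>)\<^sup>2 * real K * ln 6"
      by (simp add: N_def ln_realpow)
    then have "real (card U) \<le> real K * ln 6 / 2" using U(2) assms by simp
    also have "\<dots> \<le> real K" using mult_left_mono[OF \<open>ln (6 :: real) \<le> 2\<close>, of "real K"] by simp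
    finally have cardU: "card U \<le> K" by simp
    have finU: "finite U" using U(1) by (rule finite_subset) (simp add: V_def)
    have F: "F u \<subseteq> {..<m}" "card (F u) \<le> \<chi>" for u
      using gS[of u] by (auto simp: F_def gaps_def S_def sparse_gap_sets_def)
    have "card (\<Union>u\<in>U. F u) \<le> (\<Sum>u\<in>U. card (F u))" by (rule card_UN_le[OF finU])
    also have "\<dots> \<le> card U * \<chi>" using sum_bounded_above[of U "\<lambda>u. card (F u)" \<chi>] F(2) by simp
    also have "\<dots> \<le> q" using cardU by (simp add: q_def)
    finally obtain s where s: "s < m" "\<forall>w\<in>(\<Union>u\<in>U. F u). beats s w"
      using dominated[of "\<Union>u\<in>U. F u"] F(1) by blast
    have s_notin: "s \<notin> F v" if "v \<in> out_nbrs_set (with_proj T) U" for v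
      using out[of U s v] s(2) that by blast
    \<comment> \<open>No vertex of the out-neighbourhood has a gap at \<open>s\<close>, so membership of \<open>s\<close> is a proper
      colouring.\<close>
    have "proper_colouring (with_proj H \<restriction> out_nbrs_set (with_proj T) U) 2 (\<lambda>v. of_bool (s \<in> g v))"
      unfolding proper_colouring_def
    proof (intro conjI allI ballI impI)
      fix u v assume "u \<rightarrow>\<^bsub>with_proj H \<restriction> out_nbrs_set (with_proj T) U\<^esub> v"
      then have uv: "(u, v) \<in> parcs G" "u \<in> out_nbrs_set (with_proj T) U" "v \<in> out_nbrs_set (with_proj T) U"
        using H(3) by (auto simp: arcs_ends_def arc_to_ends_def)
      have lt: "u < n" "v < n" and disj: "g u \<inter> g v = {}" using uv(1) by (auto simp: aG)
      have "s \<notin> g w \<longleftrightarrow> Suc s \<in> g w" if "w < n" "s \<notin> F w" for w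
        using that s(1) gS[of w] by (auto simp: F_def gaps_def S_def sparse_gap_sets_def path_stable_def)
      with lt s_notin uv(2,3) disj show "(of_bool (s \<in> g u) :: nat) \<noteq> of_bool (s \<in> g v)"
        by (auto simp: disjoint_iff)
    qed simp
    then show ?thesis unfolding chromatic_number_def by (intro Least_le) blast
  qed
  show "\<exists>N\<ge>M. N \<ge> 1 \<and>
    (\<exists>(V :: nat set) (G :: nat pair_pre_digraph) (T :: nat pair_pre_digraph).
       card V = N \<and>
       pair_graph G \<and> pverts G = V \<and>
       pair_tournament T \<and> pverts T = V \<and>
       chromatic_number (with_proj G) = \<chi> \<and>
       (\<forall>U. U \<subseteq> V \<and> real (card U) \<le> ln (real N) / (2 * (real \<chi>)\<^sup>2) \<longrightarrow>
          chromatic_number (with_proj G \<restriction> out_nbrs_set (with_proj T) U) \<le> 2))"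
  proof (intro exI conjI)
    show "M \<le> N" by fact
    show "1 \<le> N" by (simp add: N_def)
    show "card V = N" by (simp add: V_def)
    show "pair_graph H" "pverts H = V" "pair_tournament T" "pverts T = V"
      "chromatic_number (with_proj H) = \<chi>" by fact+
    show "\<forall>U. U \<subseteq> V \<and> real (card U) \<le> ln (real N) / (2 * (real \<chi>)\<^sup>2) \<longrightarrow>
        chromatic_number (with_proj H \<restriction> out_nbrs_set (with_proj T) U) \<le> 2"
      using two by blast
  qed
qed

end
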